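(* Fix $q\in(0,1/2)$ and $m\ge1$. Let $\psi_m:\{0,\ldots,m\}^2\to[0,\infty]$ be deterministic, nonincreasing in its first argument and nondecreasing in its second, and consider the count rule based on $\psi_m$ at level $q$ (defined in the context). (1) If $\psi_m(m,0)\le q$, then for every $c<1/2$ there is an all-null vector of exactly uniform PRDS $p$-values, with a strictly positive joint density on $(0,1)^m$, for which the count rule has $\mathrm{FDR}>c$. (2) If $\psi_m(m,0)>q$, then the count rule never rejects, for any input vector. Consequently, every deterministic monotone rule based only on the two tail counts is either invalid over this class (its FDR exceeds $q$ for some all-null exactly uniform PRDS vector with strictly positive joint density) or identically powerless (it never rejects).
   Context: For signed scores $W_1,\ldots,W_m$ and $t>0$, put $N_+(t)=\#\{i:W_i\ge t\}$, $N_-(t)=\#\{i:W_i\le -t\}$, and $\mathcal T=\{|W_i|:|W_i|>0\}$. The count rule based on $\psi_m$ at level $q$ uses $$\widehat t_\psi=\min\{t\in\mathcal T:\psi_m\{N_+(t),N_-(t)\}\le q\},$$ with $\widehat t_\psi=\infty$ when the set is empty, and rejects $\widehat{\mathcal R}=\{i:W_i\ge\widehat t_\psi\}$. It is applied to $p$-values $P_1,\ldots,P_m$ through the scores $W_i=1/2-P_i$. With $\mathcal H_0$ the set of true nulls, $\mathrm{FDR}=\mathbb E\{|\widehat{\mathcal R}\cap\mathcal H_0|/\max(|\widehat{\mathcal R}|,1)\}$; "all-null" means $\mathcal H_0=\{1,\ldots,m\}$. A vector $P$ is PRDS if, for every coordinatewise increasing measurable set $D$ and every null index $i$, the map $u\mapsto\mathbb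 P(P\in D\mid P_i=u)$ is nondecreasing. *)

theory Defs
  imports "HOL-Probability.Probability"
begin

section \<open>Count rules based on the two tail counts\<close>

text \<open>Hypotheses are indexed by \<open>{1..m}\<close>; the values of score vectors outside this set are irrelevant.\<close>

definition tail_pos :: "nat \<Rightarrow> (nat \<Rightarrow> real) \<Rightarrow> real \<Rightarrow> nat" where
  "tail_pos m W t = card {i \<in> {1..m}. W i \<ge> t}"

definition tail_neg :: "nat \<Rightarrow> (nat \<Rightarrow> real) \<Rightarrow> real \<Rightarrow> nat" where
  "tail_neg m W t = card {i \<in> {1..m}. W i \<le> - t}"

definition thresholds :: "nat \<Rightarrow> (nat \<Rightarrow> real) \<Rightarrow> real set" where
  "thresholds m W = {\<bar>W i\<bar> | i. i \<in> {1..m} \<and> \<bar>W i\<bar> > 0}"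

definition count_threshold ::
  "nat \<Rightarrow> (nat \<Rightarrow> nat \<Rightarrow> ennreal) \<Rightarrow> real \<Rightarrow> (nat \<Rightarrow> real) \<Rightarrow> ereal" where
  "count_threshold m \<psi> q W =
    (let T = {t \<in> thresholds m W. \<psi> (tail_pos m W t) (tail_neg m W t) \<le> ennreal q}
     in if T = {} then \<infinity> else ereal (Min T))"

definition count_rule ::
  "nat \<Rightarrow> (nat \<Rightarrow> nat \<Rightarrow> ennreal) \<Rightarrow> real \<Rightarrow> (nat \<Rightarrow> real) \<Rightarrow> nat set" where
  "count_rule m \<psi> q W = {i \<in> {1..m}. ereal (W i) \<ge> count_threshold m \<psi> q W}"

definition pvalue_scores :: "(nat \<Rightarrow> real) \<Rightarrow> nat \<Rightarrow> real" where
  "pvalue_scores p = (\<lambda>i. 1 / 2 - p i)"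

definition FDR ::
  "'a measure \<Rightarrow> nat \<Rightarrow> (nat \<Rightarrow> nat \<Rightarrow> ennreal) \<Rightarrow> real \<Rightarrow> nat set \<Rightarrow> (nat \<Rightarrow> 'a \<Rightarrow> real) \<Rightarrow> real" where
  "FDR M m \<psi> q H0 P =
    (\<integral>\<omega>. (let R = count_rule m \<psi> q (pvalue_scores (\<lambda>i. P i \<omega>))
          in real (card (R \<inter> H0)) / max (real (card R)) 1) \<partial>M)"

section \<open>Random vectors of p-values\<close>

definition pvector :: "nat \<Rightarrow> (nat \<Rightarrow> 'a \<Rightarrow> real) \<Rightarrow> 'a \<Rightarrow> nat \<Rightarrow> real" where
  "pvector m P \<omega> = (\<lambda>i\<in>{1..m}. P i \<omega>)"

definition increasing_set :: "nat \<Rightarrow> (nat \<Rightarrow> real) set \<Rightarrow> bool" where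
  "increasing_set m D \<longleftrightarrow>
    (\<forall>x\<in>D. \<forall>y \<in> extensional {1..m}. (\<forall>i\<in>{1..m}. x i \<le> y i) \<longrightarrow> y \<in> D)"

text \<open>
  The map \<open>u \<mapsto> \<P>(P \<in> D | P i = u)\<close> is determined only up to a null set of the law of \<open>P i\<close>.
  As usual, it is called nondecreasing if it has a nondecreasing version \<open>g\<close>, that is, if
  \<open>g \<circ> P i\<close> is a version of the conditional expectation of the indicator of \<open>P \<in> D\<close>
  given the sigma-algebra generated by \<open>P i\<close>.
\<close>

definition PRDS :: "'a measure \<Rightarrow> nat \<Rightarrow> nat set \<Rightarrow> (nat \<Rightarrow> 'a \<Rightarrow> real) \<Rightarrow> bool" where
  "PRDS M m H0 P \<longleftrightarrow>
    (\<forall>D \<in> sets (\<Pi>\<^sub>M i\<in>{1..m}. borel). increasing_set m D \<longrightarrow>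
      (\<forall>i\<in>H0. \<exists>g :: real \<Rightarrow> real. mono_on {0..1} g \<and>
        (AE \<omega> in M. real_cond_exp M (vimage_algebra (space M) (P i) borel)
           (indicator {\<omega> \<in> space M. pvector m P \<omega> \<in> D}) \<omega> = g (P i \<omega>))))"

definition exactly_uniform :: "'a measure \<Rightarrow> nat set \<Rightarrow> (nat \<Rightarrow> 'a \<Rightarrow> real) \<Rightarrow> bool" where
  "exactly_uniform M H0 P \<longleftrightarrow>
    (\<forall>i\<in>H0. P i \<in> borel_measurable M \<and> distr M borel (P i) = uniform_measure lborel {0..1})"

definition positive_joint_density :: "'a measure \<Rightarrow> nat \<Rightarrow> (nat \<Rightarrow> 'a \<Rightarrow> real) \<Rightarrow> bool" where
  "positive_joint_density M m P \<longleftrightarrow>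
    (\<exists>f :: (nat \<Rightarrow> real) \<Rightarrow> real.
      distributed M (\<Pi>\<^sub>M i\<in>{1..m}. lborel) (pvector m P) (\<lambda>x. ennreal (f x)) \<and>
      (\<forall>x \<in> (\<Pi>\<^sub>E i\<in>{1..m}. {0<..<1}). f x > 0))"

definition all_null_uniform_PRDS :: "'a measure \<Rightarrow> nat \<Rightarrow> (nat \<Rightarrow> 'a \<Rightarrow> real) \<Rightarrow> bool" where
  "all_null_uniform_PRDS M m P \<longleftrightarrow>
    prob_space M \<and> exactly_uniform M {1..m} P \<and> PRDS M m {1..m} P \<and> positive_joint_density M m P"

end

theory Submission
  imports Defs
begin

text \<open>
  Flip a fair coin and, given the outcome, draw the \<open>p\<close>-values independently from a density that
  takes the value \<open>2 (1 - e)\<close> on one of the two halves of \<open>[0, 1]\<close> and \<open>2 e\<close> on the other; the coin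
  selects the favoured half. The margins are exactly uniform because the two densities average to 1.
  Given \<open>P i = u\<close>, the coin favours the upper half with probability \<open>e\<close> or \<open>1 - e\<close>, which is
  nondecreasing in \<open>u\<close>, and the other coordinates are stochastically larger under the upper coin;
  this gives PRDS. With probability at least \<open>(1 - e) ^ m / 2\<close> all \<open>p\<close>-values are below \<open>1 / 2\<close>.
  Then all scores are positive, the smallest score has counts \<open>(m, 0)\<close>, and the rule rejects. As all
  hypotheses are null, the false discovery proportion is 1 whenever something is rejected.
\<close>

section \<open>The two coin-dependent densities and their product integrals\<close>

text \<open>The coin is \<open>k\<close>; the value \<open>True\<close> favours the upper half.\<close>

definition tilt :: "real \<Rightarrow> bool \<Rightarrow> real \<Rightarrow> real" where
  "tilt e k u = (if (u < 1 / 2) = k then e else 1 - e)"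

text \<open>The factor \<open>tilt\<close> is kept apart from the normalisation and the cutoff: it
  is monotone in \<open>u\<close> on the whole line for the upper coin, and it returns as the
  posterior weight of the coin.\<close>

definition tilt_density :: "real \<Rightarrow> bool \<Rightarrow> real \<Rightarrow> real" where
  "tilt_density e k u = 2 * tilt e k u * indicator {0..1} u"

text \<open>The expectation of \<phi> over independent coordinates in \<open>J\<close>, given the
  coin \<open>k\<close>. Keeping \<open>J\<close> variable allows coordinates to be split off one at
  a time.\<close>

definition tilt_integral ::
  "real \<Rightarrow> bool \<Rightarrow> nat set \<Rightarrow> ((nat \<Rightarrow> real) \<Rightarrow> ennreal) \<Rightarrow> ennreal" where
  "tilt_integral e k J \<phi> =
    (\<integral>\<^sup>+x. \<phi> x * (\<Prod>j\<in>J. ennreal (tilt_density e k (x j))) \<partial>(\<Pi>\<^sub>M j\<in>J. lborel))"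

lemma tilt_measurable [measurable]: "tilt e k \<in> borel_measurable borel"
  unfolding tilt_def by (cases k) simp_all

lemma tilt_density_measurable [measurable]: "tilt_density e k \<in> borel_measurable borel"
  unfolding tilt_density_def by measurable

lemma tilt_False: "tilt e False u = 1 - tilt e True u"
  by (auto simp: tilt_def)

lemma tilt_pos: "0 < e \<Longrightarrow> e \<le> 1 / 2 \<Longrightarrow> 0 < tilt e k u"
  by (auto simp: tilt_def)

lemma tilt_density_nonneg: "0 < e \<Longrightarrow> e \<le> 1 / 2 \<Longrightarrow> 0 \<le> tilt_density e k u"
  using tilt_pos[of e k u] by (simp add: tilt_density_def)

lemma tilt_True_mono: "e \<le> 1 / 2 \<Longrightarrow> mono (tilt e True)"
  by (auto simp: tilt_def mono_def)

lemma product_sigma_finite_lborel: "product_sigma_finite (\<lambda>_::nat. lborel :: real measure)"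
  by standard

lemma sets_PiM_lborel: "sets (\<Pi>\<^sub>M j\<in>J. lborel) = sets (\<Pi>\<^sub>M j\<in>J. (borel :: real measure))"
  by (intro sets_PiM_cong) simp_all

lemma measurable_PiM_lborel:
  "measurable (\<Pi>\<^sub>M j\<in>J. lborel) N = measurable (\<Pi>\<^sub>M j\<in>J. (borel :: real measure)) N"
  by (intro measurable_cong_sets sets_PiM_lborel refl)

lemma fun_upd_section_measurable:
  fixes \<phi> :: "(nat \<Rightarrow> real) \<Rightarrow> ennreal"
  assumes "\<phi> \<in> borel_measurable (\<Pi>\<^sub>M j\<in>insert i J. borel)"
  shows "(\<lambda>y. \<phi> (y(i := u))) \<in> borel_measurable (\<Pi>\<^sub>M j\<in>J. borel)"
  by (rule measurable_compose[OF _ assms], rule measurable_fun_upd[of _ J]) auto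

text \<open>The update map is jointly measurable in \<open>u\<close> and \<open>y\<close>, so
  integrating out \<open>y\<close> leaves a measurable function of \<open>u\<close>.\<close>

lemma tilt_integral_section_measurable:
  fixes \<phi> :: "(nat \<Rightarrow> real) \<Rightarrow> ennreal"
  assumes "finite J" and [measurable]: "\<phi> \<in> borel_measurable (\<Pi>\<^sub>M j\<in>insert i J. borel)"
  shows "(\<lambda>u. tilt_integral e k J (\<lambda>y. \<phi> (y(i := u)))) \<in> borel_measurable borel"
proof -
  interpret finite_product_sigma_finite "\<lambda>_::nat. lborel :: real measure" J
    by standard fact
  have "(\<lambda>z. (snd z)(i := fst z)) \<in> borel \<Otimes>\<^sub>M (\<Pi>\<^sub>M j\<in>J. lborel) \<rightarrow>\<^sub>M (\<Pi>\<^sub>M j\<in>insert i J. (borel :: real measure))"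
    by (rule measurable_fun_upd[of _ J])
      (auto simp: measurable_cong_sets[OF refl sets_PiM_lborel[symmetric]])
  then have [measurable]: "(\<lambda>z. \<phi> ((snd z)(i := fst z))) \<in> borel_measurable (borel \<Otimes>\<^sub>M (\<Pi>\<^sub>M j\<in>J. lborel))"
    by measurable
  show ?thesis
    unfolding tilt_integral_def
    by (rule borel_measurable_nn_integral) (simp add: case_prod_beta')
qed

text \<open>Tonelli with the new coordinate outermost. This order serves both the induction over
  coordinates and the conditioning on a single p-value.\<close>

lemma tilt_integral_insert:
  assumes J: "finite J" "i \<notin> J"
    and \<phi> [measurable]: "\<phi> \<in> borel_measurable (\<Pi>\<^sub>M j\<in>insert i J. borel)"
  shows "tilt_integral e k (insert i J) \<phi> =
    (\<integral>\<^sup>+u. ennreal (tilt_density e k u) * tilt_integral e k J (\<lambda>y. \<phi> (y(i := u))) \<partial>lborel)"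
proof -
  interpret product_sigma_finite "\<lambda>_::nat. lborel :: real measure"
    by (rule product_sigma_finite_lborel)
  have [measurable]: "\<phi> \<in> borel_measurable (\<Pi>\<^sub>M j\<in>insert i J. lborel)"
    using \<phi> by (simp add: measurable_PiM_lborel)
  have [measurable]: "(\<lambda>y. \<phi> (y(i := u))) \<in> borel_measurable (\<Pi>\<^sub>M j\<in>J. lborel)" for u
    using fun_upd_section_measurable[OF \<phi>] by (simp add: measurable_PiM_lborel)
  have upd: "(\<Prod>j\<in>insert i J. ennreal (tilt_density e k ((y(i := u)) j))) =
      ennreal (tilt_density e k u) * (\<Prod>j\<in>J. ennreal (tilt_density e k (y j)))" for y u
    using J by (auto intro!: arg_cong2[where f = "(*)"] prod.cong)
  have "tilt_integral e k (insert i J) \<phi> =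
      (\<integral>\<^sup>+u. (\<integral>\<^sup>+y. \<phi> (y(i := u)) *
        (\<Prod>j\<in>insert i J. ennreal (tilt_density e k ((y(i := u)) j))) \<partial>(\<Pi>\<^sub>M j\<in>J. lborel)) \<partial>lborel)"
    unfolding tilt_integral_def using J by (subst product_nn_integral_insert_rev) auto
  also have "\<dots> = (\<integral>\<^sup>+u. ennreal (tilt_density e k u) *
      tilt_integral e k J (\<lambda>y. \<phi> (y(i := u))) \<partial>lborel)"
    unfolding tilt_integral_def upd
    by (intro nn_integral_cong, subst nn_integral_cmult[symmetric]) (auto simp: mult_ac)
  finally show ?thesis .
qed

section \<open>Stochastic ordering of the two product laws\<close>

lemma tilt_integral_mono:
  assumes "\<And>x. x \<in> extensional J \<Longrightarrow> \<phi> x \<le> \<phi>' x"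
  shows "tilt_integral e k J \<phi> \<le> tilt_integral e k J \<phi>'"
  unfolding tilt_integral_def
  by (intro nn_integral_mono mult_right_mono) (auto simp: space_PiM PiE_def intro: assms)

text \<open>On each half the density is constant; the arguments 0 and 1 of \<open>tilt\<close>
  merely represent the lower and the upper half.\<close>

lemma nn_integral_tilt_density:
  fixes \<phi> :: "real \<Rightarrow> ennreal"
  assumes [measurable]: "\<phi> \<in> borel_measurable borel"
  shows "(\<integral>\<^sup>+u. ennreal (tilt_density e k u) * \<phi> u \<partial>lborel) =
    ennreal (2 * tilt e k 0) * (\<integral>\<^sup>+u. \<phi> u * indicator {0..<1 / 2} u \<partial>lborel) +
    ennreal (2 * tilt e k 1) * (\<integral>\<^sup>+u. \<phi> u * indicator {1 / 2..1} u \<partial>lborel)"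
proof -
  have "(\<integral>\<^sup>+u. ennreal (tilt_density e k u) * \<phi> u \<partial>lborel) =
     (\<integral>\<^sup>+u. ennreal (2 * tilt e k 0) * (\<phi> u * indicator {0..<1 / 2} u) +
           ennreal (2 * tilt e k 1) * (\<phi> u * indicator {1 / 2..1} u) \<partial>lborel)"
    by (intro nn_integral_cong) (auto simp: tilt_density_def tilt_def split: split_indicator)
  then show ?thesis
    by (simp add: nn_integral_add nn_integral_cmult)
qed

text \<open>Passing from the lower to the upper coin moves the surplus density \<open>d\<close> from
  the lower half to the upper half, where an increasing function has the larger integral.\<close>

lemma nn_integral_tilt_density_le:
  fixes \<phi> :: "real \<Rightarrow> ennreal"
  assumes e: "0 < e" "e \<le> 1 / 2" and "mono \<phi>" and [measurable]: "\<phi> \<in> borel_measurable borel"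
  shows "(\<integral>\<^sup>+u. ennreal (tilt_density e False u) * \<phi> u \<partial>lborel) \<le>
         (\<integral>\<^sup>+u. ennreal (tilt_density e True u) * \<phi> u \<partial>lborel)"
proof -
  define A where "A = (\<integral>\<^sup>+u. \<phi> u * indicator {0..<1 / 2} u \<partial>lborel)"
  define B where "B = (\<integral>\<^sup>+u. \<phi> u * indicator {1 / 2..1} u \<partial>lborel)"
  \<comment> \<open>Both halves have the same length, so the constant value at the midpoint
    separates the two integrals.\<close>
  have "A \<le> (\<integral>\<^sup>+u. \<phi> (1 / 2) * indicator {0..<1 / 2 :: real} u \<partial>lborel)"
    unfolding A_def by (intro nn_integral_mono) (auto split: split_indicator intro: monoD[OF \<open>mono \<phi>\<close>])
  also have "\<dots> = (\<integral>\<^sup>+u. \<phi> (1 / 2) * indicator {1 / 2..1 :: real} u \<partial>lborel)"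
    by (simp add: nn_integral_cmult_indicator)
  also have "\<dots> \<le> B"
    unfolding B_def by (intro nn_integral_mono) (auto split: split_indicator intro: monoD[OF \<open>mono \<phi>\<close>])
  finally have "A \<le> B" .
  \<comment> \<open>The difference between the favoured height \<open>2 * (1 - e)\<close> and the
    other height \<open>2 * e\<close>; it is nonnegative because \<open>e\<close> is at most
    1/2.\<close>
  define d where "d = ennreal (2 - 4 * e)"
  have d: "ennreal (2 * (1 - e)) = ennreal (2 * e) + d"
    using e by (simp add: d_def flip: ennreal_plus)
  have "ennreal (2 * (1 - e)) * A + ennreal (2 * e) * B = ennreal (2 * e) * A + ennreal (2 * e) * B + d * A"
    unfolding d by (simp only: distrib_right add.assoc add.commute[of "d * A"])
  also have "\<dots> \<le> ennreal (2 * e) * A + ennreal (2 * e) * B + d * B"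
    by (intro add_left_mono mult_left_mono \<open>A \<le> B\<close>) simp
  also have "\<dots> = ennreal (2 * e) * A + ennreal (2 * (1 - e)) * B"
    unfolding d by (simp only: distrib_right add.assoc)
  finally show ?thesis
    by (simp add: nn_integral_tilt_density tilt_def A_def B_def)
qed

text \<open>Stochastic dominance passes to products by induction on the coordinates: the coin is
  switched first in the inner coordinates with \<open>u\<close> fixed, then in the outer
  one.\<close>

lemma tilt_integral_False_le_True:
  assumes e: "0 < e" "e \<le> 1 / 2" and "finite J"
    and "\<phi> \<in> borel_measurable (\<Pi>\<^sub>M j\<in>J. borel)"
    and "\<And>x y. x \<in> extensional J \<Longrightarrow> y \<in> extensional J \<Longrightarrow> (\<And>j. j \<in> J \<Longrightarrow> x j \<le> y j) \<Longrightarrow> \<phi> x \<le> \<phi> y"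
  shows "tilt_integral e False J \<phi> \<le> tilt_integral e True J \<phi>"
  using \<open>finite J\<close> assms(4,5)
proof (induction J arbitrary: \<phi> rule: finite_induct)
  case empty
  then show ?case by (simp add: tilt_integral_def)
next
  case (insert i J)
  note \<phi> = \<open>\<phi> \<in> borel_measurable (\<Pi>\<^sub>M j\<in>insert i J. borel)\<close>
  let ?s = "\<lambda>u y. \<phi> (y(i := u))"
  have ext: "y(i := u) \<in> extensional (insert i J)" if "y \<in> extensional J" for y u
    using that by (auto simp: extensional_def)
  have "tilt_integral e False (insert i J) \<phi> =
      (\<integral>\<^sup>+u. ennreal (tilt_density e False u) * tilt_integral e False J (?s u) \<partial>lborel)"
    by (rule tilt_integral_insert[OF insert(1,2) \<phi>])
  also have "\<dots> \<le> (\<integral>\<^sup>+u. ennreal (tilt_density e False u) * tilt_integral e True J (?s u) \<partial>lborel)"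
  proof (intro nn_integral_mono mult_left_mono insert.IH fun_upd_section_measurable[OF \<phi>])
    fix u and x y :: "nat \<Rightarrow> real" assume "x \<in> extensional J" "y \<in> extensional J" "\<And>j. j \<in> J \<Longrightarrow> x j \<le> y j"
    then show "?s u x \<le> ?s u y"
      by (intro insert.prems(2) ext) auto
  qed simp
  \<comment> \<open>The inner integral is now increasing in \<open>u\<close>, so the one-dimensional
    comparison applies to it.\<close>
  also have "\<dots> \<le> (\<integral>\<^sup>+u. ennreal (tilt_density e True u) * tilt_integral e True J (?s u) \<partial>lborel)"
  proof (intro nn_integral_tilt_density_le[OF e] tilt_integral_section_measurable[OF insert(1) \<phi>] monoI
      tilt_integral_mono)
    fix u v :: real and x :: "nat \<Rightarrow> real" assume "u \<le> v" "x \<in> extensional J"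
    then show "?s u x \<le> ?s v x"
      by (intro insert.prems(2) ext) auto
  qed
  also have "\<dots> = tilt_integral e True (insert i J) \<phi>"
    by (rule tilt_integral_insert[OF insert(1,2) \<phi>, symmetric])
  finally show ?case .
qed

section \<open>Normalisation and factorisation\<close>

lemma tilt_density_total:
  assumes "0 < e" "e \<le> 1 / 2"
  shows "(\<integral>\<^sup>+u. ennreal (tilt_density e k u) \<partial>lborel) = 1"
proof -
  have "ennreal (2 * tilt e k 0) * ennreal (1 / 2) + ennreal (2 * tilt e k 1) * ennreal (1 / 2) =
      ennreal (tilt e k 0 + tilt e k 1)"
    using tilt_pos[OF assms, of k 0] tilt_pos[OF assms, of k 1]
    by (subst ennreal_plus) (simp_all flip: ennreal_mult del: ennreal_half)
  also have "\<dots> = 1"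
    by (simp add: tilt_def)
  finally show ?thesis
    using nn_integral_tilt_density[of "\<lambda>_. 1" e k] by simp
qed

text \<open>Independence given the coin. It yields the total mass and, later, the probability that
  all coordinates fall in the lower half.\<close>

lemma tilt_integral_prod:
  assumes "finite J" and [measurable]: "g \<in> borel_measurable borel"
  shows "tilt_integral e k J (\<lambda>x. \<Prod>j\<in>J. g (x j)) =
    (\<integral>\<^sup>+u. g u * ennreal (tilt_density e k u) \<partial>lborel) ^ card J"
proof -
  interpret product_sigma_finite "\<lambda>_::nat. lborel :: real measure"
    by (rule product_sigma_finite_lborel)
  show ?thesis
    using product_nn_integral_prod[OF \<open>finite J\<close>, of "\<lambda>_ u. g u * ennreal (tilt_density e k u)"]
    by (simp add: tilt_integral_def prod.distrib)
qed

lemma tilt_integral_one: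
  assumes "0 < e" "e \<le> 1 / 2" "finite J"
  shows "tilt_integral e k J (\<lambda>_. 1) = 1"
  using tilt_integral_prod[OF \<open>finite J\<close>, of "\<lambda>_. 1" e k] tilt_density_total[OF assms(1,2), of k]
  by simp

section \<open>The mixture over the coin and its disintegration along one coordinate\<close>

definition mixture_density :: "real \<Rightarrow> nat \<Rightarrow> (nat \<Rightarrow> real) \<Rightarrow> real" where
  "mixture_density e m x =
    ((\<Prod>j\<in>{1..m}. tilt_density e False (x j)) + (\<Prod>j\<in>{1..m}. tilt_density e True (x j))) / 2"

text \<open>The coin is already averaged out: the sample space consists of the p-value vectors
  themselves, and the p-values are the coordinate maps.\<close>

definition mixture :: "real \<Rightarrow> nat \<Rightarrow> (nat \<Rightarrow> real) measure" where
  "mixture e m = density (\<Pi>\<^sub>M j\<in>{1..m}. lborel) (\<lambda>x. ennreal (mixture_density e m x))"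

lemma mixture_density_measurable [measurable]:
  "mixture_density e m \<in> borel_measurable (\<Pi>\<^sub>M j\<in>{1..m}. lborel)"
  unfolding mixture_density_def by measurable

lemma sets_mixture: "sets (mixture e m) = sets (\<Pi>\<^sub>M j\<in>{1..m}. borel)"
  by (simp add: mixture_def sets_PiM_lborel)

lemma space_mixture: "space (mixture e m) = extensional {1..m}"
  by (simp add: mixture_def space_PiM PiE_def)

lemma measurable_mixture:
  "measurable (mixture e m) N = measurable (\<Pi>\<^sub>M j\<in>{1..m}. (borel :: real measure)) N"
  by (intro measurable_cong_sets sets_mixture refl)

lemma component_measurable_mixture:
  "i \<in> {1..m} \<Longrightarrow> (\<lambda>x. x i) \<in> borel_measurable (mixture e m)"
  unfolding measurable_mixture by (rule measurable_component_singleton)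

lemma nn_integral_mixture:
  assumes e: "0 < e" "e \<le> 1 / 2" and \<phi>: "\<phi> \<in> borel_measurable (\<Pi>\<^sub>M j\<in>{1..m}. borel)"
  shows "(\<integral>\<^sup>+x. \<phi> x \<partial>mixture e m) =
    ennreal (1 / 2) * (tilt_integral e False {1..m} \<phi> + tilt_integral e True {1..m} \<phi>)"
proof -
  have [measurable]: "\<phi> \<in> borel_measurable (\<Pi>\<^sub>M j\<in>{1..m}. lborel)"
    using \<phi> by (simp add: measurable_PiM_lborel)
  have prod: "(\<Prod>j\<in>{1..m}. ennreal (tilt_density e k (x j))) = ennreal (\<Prod>j\<in>{1..m}. tilt_density e k (x j))" for k x
    by (intro prod_ennreal tilt_density_nonneg e)
  have nn: "0 \<le> (\<Prod>j\<in>{1..m}. tilt_density e k (x j))" for k x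
    by (intro prod_nonneg ballI tilt_density_nonneg e)
  have dens: "ennreal (mixture_density e m x) = ennreal (1 / 2) *
      ((\<Prod>j\<in>{1..m}. ennreal (tilt_density e False (x j))) + (\<Prod>j\<in>{1..m}. ennreal (tilt_density e True (x j))))" for x
    unfolding prod mixture_density_def ennreal_plus[OF nn nn, symmetric]
    using nn[of False x] nn[of True x] by (subst ennreal_mult[symmetric]) auto
  let ?w = "\<lambda>k x. \<Prod>j\<in>{1..m}. ennreal (tilt_density e k (x j))"
  have [measurable]: "?w k \<in> borel_measurable (\<Pi>\<^sub>M j\<in>{1..m}. lborel)" for k
    by measurable
  have "(\<integral>\<^sup>+x. \<phi> x \<partial>mixture e m) =
      (\<integral>\<^sup>+x. ennreal (mixture_density e m x) * \<phi> x \<partial>(\<Pi>\<^sub>M j\<in>{1..m}. lborel))"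
    unfolding mixture_def by (rule nn_integral_density) measurable
  also have "\<dots> = (\<integral>\<^sup>+x. ennreal (1 / 2) * (\<phi> x * ?w False x + \<phi> x * ?w True x) \<partial>(\<Pi>\<^sub>M j\<in>{1..m}. lborel))"
    unfolding dens by (simp only: distrib_left distrib_right mult_ac)
  also have "\<dots> = ennreal (1 / 2) * (\<integral>\<^sup>+x. \<phi> x * ?w False x + \<phi> x * ?w True x \<partial>(\<Pi>\<^sub>M j\<in>{1..m}. lborel))"
    by (rule nn_integral_cmult) measurable
  also have "(\<integral>\<^sup>+x. \<phi> x * ?w False x + \<phi> x * ?w True x \<partial>(\<Pi>\<^sub>M j\<in>{1..m}. lborel)) =
      tilt_integral e False {1..m} \<phi> + tilt_integral e True {1..m} \<phi>"
    unfolding tilt_integral_def by (rule nn_integral_add) measurable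
  finally show ?thesis .
qed

text \<open>Bayes' rule for the coin: the prior 1/2 cancels the factor 2 of
  \<open>tilt_density\<close>, leaving the uniform law of \<open>u\<close> with the posterior
  weights \<open>tilt e k u\<close>.\<close>

lemma nn_integral_mixture_disintegrate:
  assumes e: "0 < e" "e \<le> 1 / 2" and i: "i \<in> {1..m}" and \<phi>: "\<phi> \<in> borel_measurable (\<Pi>\<^sub>M j\<in>{1..m}. borel)"
  shows "(\<integral>\<^sup>+x. \<phi> x \<partial>mixture e m) =
    (\<integral>\<^sup>+u. indicator {0..1} u *
      (ennreal (tilt e False u) * tilt_integral e False ({1..m} - {i}) (\<lambda>y. \<phi> (y(i := u))) +
       ennreal (tilt e True u) * tilt_integral e True ({1..m} - {i}) (\<lambda>y. \<phi> (y(i := u)))) \<partial>lborel)"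
proof -
  define J where "J = {1..m} - {i}"
  let ?I = "\<lambda>k u. tilt_integral e k J (\<lambda>y. \<phi> (y(i := u)))"
  have J: "finite J" "i \<notin> J" "insert i J = {1..m}" using i by (auto simp: J_def)
  have \<phi>': "\<phi> \<in> borel_measurable (\<Pi>\<^sub>M j\<in>insert i J. borel)" using \<phi> by (simp only: J)
  have [measurable]: "?I k \<in> borel_measurable borel" for k
    by (rule tilt_integral_section_measurable[OF J(1) \<phi>'])
  have split: "tilt_integral e k {1..m} \<phi> = (\<integral>\<^sup>+u. ennreal (tilt_density e k u) * ?I k u \<partial>lborel)" for k
    using tilt_integral_insert[OF J(1,2) \<phi>'] by (simp only: J)
  have half: "ennreal (1 / 2) * (ennreal (tilt_density e k u) * z) = indicator {0..1} u * (ennreal (tilt e k u) * z)" for k u z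
    using tilt_pos[OF e, of k u]
    by (auto simp: tilt_density_def mult.assoc[symmetric] simp del: ennreal_half simp flip: ennreal_mult split: split_indicator)
  have "(\<integral>\<^sup>+x. \<phi> x \<partial>mixture e m) = (\<integral>\<^sup>+u. ennreal (1 / 2) *
      (ennreal (tilt_density e False u) * ?I False u + ennreal (tilt_density e True u) * ?I True u) \<partial>lborel)"
    unfolding nn_integral_mixture[OF e \<phi>] split
    by (simp add: nn_integral_add nn_integral_cmult del: ennreal_half)
  then show ?thesis
    by (simp only: distrib_left half J_def)
qed

lemma tilt_integral_const:
  assumes "0 < e" "e \<le> 1 / 2" "finite J"
  shows "tilt_integral e k J (\<lambda>_. c) = c"
  using tilt_integral_one[OF assms, of k] unfolding tilt_integral_def
  by (subst nn_integral_cmult) simp_all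

lemma tilt_add:
  assumes "0 < e" "e \<le> 1 / 2"
  shows "ennreal (tilt e False u) * c + ennreal (tilt e True u) * c = c"
proof -
  have "ennreal (tilt e False u) + ennreal (tilt e True u) = 1"
    using tilt_pos[OF assms, of False u] tilt_pos[OF assms, of True u]
    by (simp add: tilt_False flip: ennreal_plus)
  then show ?thesis by (simp flip: distrib_right)
qed

text \<open>A function of coordinate \<open>i\<close> alone makes both inner integrals equal to
  \<open>g u\<close>, and the posterior weights add up to one.\<close>

lemma nn_integral_mixture_component:
  assumes e: "0 < e" "e \<le> 1 / 2" and i: "i \<in> {1..m}" and [measurable]: "g \<in> borel_measurable borel"
  shows "(\<integral>\<^sup>+x. g (x i) \<partial>mixture e m) = (\<integral>\<^sup>+u. indicator {0..1} u * g u \<partial>lborel)"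
proof -
  have "(\<lambda>x. g (x i)) \<in> borel_measurable (\<Pi>\<^sub>M j\<in>{1..m}. borel)"
    using i by measurable
  from nn_integral_mixture_disintegrate[OF e i this] show ?thesis
    by (simp add: tilt_integral_const[OF e] tilt_add[OF e])
qed

section \<open>Uniform margins and positive joint density\<close>

lemma prob_space_mixture:
  assumes e: "0 < e" "e \<le> 1 / 2"
  shows "prob_space (mixture e m)"
proof
  have "(\<integral>\<^sup>+x. 1 \<partial>mixture e m) = ennreal (1 / 2) * ennreal (1 + 1)"
    by (subst nn_integral_mixture[OF e]) (simp_all add: tilt_integral_one[OF e] del: ennreal_half)
  also have "\<dots> = 1"
    by (subst ennreal_mult[symmetric]) simp_all
  finally show "emeasure (mixture e m) (space (mixture e m)) = 1"
    by simp
qed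

lemma exactly_uniform_mixture:
  assumes e: "0 < e" "e \<le> 1 / 2"
  shows "exactly_uniform (mixture e m) {1..m} (\<lambda>i x. x i)"
  unfolding exactly_uniform_def
proof (intro ballI conjI component_measurable_mixture measure_eqI)
  fix i C assume i: "i \<in> {1..m}" and "C \<in> sets (distr (mixture e m) borel (\<lambda>x. x i))"
  then have [measurable]: "C \<in> sets borel" by simp
  note [measurable] = component_measurable_mixture[OF i]
  have "emeasure (distr (mixture e m) borel (\<lambda>x. x i)) C =
      (\<integral>\<^sup>+u. indicator C u \<partial>distr (mixture e m) borel (\<lambda>x. x i))"
    by simp
  also have "\<dots> = (\<integral>\<^sup>+x. indicator C (x i) \<partial>mixture e m)"
    by (subst nn_integral_distr) simp_all
  also have "\<dots> = (\<integral>\<^sup>+u. indicator {0..1} u * indicator C u \<partial>lborel)"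
    by (rule nn_integral_mixture_component[OF e i]) simp
  also have "\<dots> = emeasure lborel ({0..1} \<inter> C)"
    by (simp flip: indicator_inter_arith)
  also have "\<dots> = emeasure (uniform_measure lborel {0..1}) C"
    by (simp add: divide_ennreal_def)
  finally show "emeasure (distr (mixture e m) borel (\<lambda>x. x i)) C = emeasure (uniform_measure lborel {0..1}) C" .
qed simp_all

lemma pvector_mixture: "x \<in> space (mixture e m) \<Longrightarrow> pvector m (\<lambda>i x. x i) x = x"
  by (simp add: pvector_def space_mixture extensional_restrict)

lemma positive_joint_density_mixture:
  assumes e: "0 < e" "e \<le> 1 / 2"
  shows "positive_joint_density (mixture e m) m (\<lambda>i x. x i)"
  unfolding positive_joint_density_def
proof (intro exI conjI ballI)
  let ?N = "\<Pi>\<^sub>M i\<in>{1..m}. (lborel :: real measure)"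
  have sets: "sets (mixture e m) = sets ?N"
    by (simp add: mixture_def)
  \<comment> \<open>Points of the space are extensional, so \<open>pvector\<close> acts as the
    identity there and the law of the vector is the mixture itself.\<close>
  have "pvector m (\<lambda>i x. x i) \<in> measurable (mixture e m) ?N"
    by (subst measurable_cong[OF pvector_mixture]) (simp_all only: measurable_ident_sets[OF sets])
  moreover have "distr (mixture e m) ?N (pvector m (\<lambda>i x. x i)) = mixture e m"
    by (subst distr_cong[OF refl refl pvector_mixture]) (simp_all only: distr_id2[OF sets[symmetric]])
  ultimately show "distributed (mixture e m) ?N (pvector m (\<lambda>i x. x i)) (\<lambda>x. ennreal (mixture_density e m x))"
    using measurable_compose[OF mixture_density_measurable measurable_ennreal]
    by (simp only: distributed_def) (simp add: mixture_def)
  fix x :: "nat \<Rightarrow> real" assume x: "x \<in> (\<Pi>\<^sub>E i\<in>{1..m}. {0<..<1})"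
  \<comment> \<open>Here \<open>e\<close> has to be positive: the unfavoured half then keeps density
    \<open>2 * e > 0\<close>.\<close>
  have "0 < (\<Prod>j\<in>{1..m}. tilt_density e k (x j))" for k
    using x by (intro prod_pos) (force simp: tilt_density_def PiE_def Pi_def tilt_pos[OF e] split: split_indicator)
  from this[of False] this[of True] show "0 < mixture_density e m x"
    by (simp add: mixture_density_def)
qed

section \<open>Conditional probabilities given one coordinate, and PRDS\<close>

definition section_prob :: "real \<Rightarrow> bool \<Rightarrow> nat \<Rightarrow> (nat \<Rightarrow> real) set \<Rightarrow> nat \<Rightarrow> real \<Rightarrow> real" where
  "section_prob e k m D i u =
    enn2real (tilt_integral e k ({1..m} - {i}) (\<lambda>y. indicator D (y(i := u))))"

text \<open>The section integral is the probability of \<open>D\<close> given the coin and the value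
  \<open>u\<close> of coordinate \<open>i\<close>. Comparison with the constant 1 rules out the
  value \<open>top\<close>, which \<open>enn2real\<close> would send to 0.\<close>

lemma ennreal_section_prob:
  assumes e: "0 < e" "e \<le> 1 / 2"
  shows "ennreal (section_prob e k m D i u) =
    tilt_integral e k ({1..m} - {i}) (\<lambda>y. indicator D (y(i := u)))"
    and "section_prob e k m D i u \<le> 1"
proof -
  have "tilt_integral e k ({1..m} - {i}) (\<lambda>y. indicator D (y(i := u))) \<le>
      tilt_integral e k ({1..m} - {i}) (\<lambda>_. 1)"
    by (rule tilt_integral_mono) (simp add: indicator_def)
  also have "\<dots> = 1"
    by (simp add: tilt_integral_one[OF e])
  finally have le: "tilt_integral e k ({1..m} - {i}) (\<lambda>y. indicator D (y(i := u))) \<le> 1" .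
  then have "tilt_integral e k ({1..m} - {i}) (\<lambda>y. indicator D (y(i := u))) < top"
    by (rule le_less_trans) simp
  then show eq: "ennreal (section_prob e k m D i u) =
      tilt_integral e k ({1..m} - {i}) (\<lambda>y. indicator D (y(i := u)))"
    by (simp add: section_prob_def)
  with le have "ennreal (section_prob e k m D i u) \<le> ennreal 1" by simp
  then show "section_prob e k m D i u \<le> 1"
    by (subst (asm) ennreal_le_iff) simp_all
qed

text \<open>The weights \<open>tilt e k u\<close> are the posterior probabilities of the coin \<open>k\<close> given \<open>P i = u\<close>.\<close>

definition mixture_cond_prob :: "real \<Rightarrow> nat \<Rightarrow> (nat \<Rightarrow> real) set \<Rightarrow> nat \<Rightarrow> real \<Rightarrow> real" where
  "mixture_cond_prob e m D i u =
    tilt e False u * section_prob e False m D i u + tilt e True u * section_prob e True m D i u"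

lemma increasing_setD:
  "increasing_set m D \<Longrightarrow> x \<in> D \<Longrightarrow> y \<in> extensional {1..m} \<Longrightarrow> (\<And>i. i \<in> {1..m} \<Longrightarrow> x i \<le> y i) \<Longrightarrow> y \<in> D"
  by (auto simp: increasing_set_def)

text \<open>Raising \<open>u\<close> acts in two ways, both upward: it shifts posterior weight to
  the upper coin, under which an increasing set is more likely, and it enlarges the section of
  \<open>D\<close> under either coin.\<close>

lemma mono_mixture_cond_prob:
  assumes e: "0 < e" "e \<le> 1 / 2" and i: "i \<in> {1..m}"
    and D: "D \<in> sets (\<Pi>\<^sub>M j\<in>{1..m}. borel)" "increasing_set m D"
  shows "mono (mixture_cond_prob e m D i)"
proof (rule monoI)
  fix u v :: real assume "u \<le> v"
  let ?h = "\<lambda>k. section_prob e k m D i" and ?J = "{1..m} - {i}"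
  have ins: "insert i ?J = {1..m}" using i by auto
  \<comment> \<open>This is stated for two points and two values at once: \<open>h_mono\<close> uses
    it with equal points, \<open>h_le\<close> with equal values.\<close>
  have le: "indicator D (x(i := u)) \<le> (indicator D (y(i := v)) :: ennreal)"
    if "x \<in> extensional ?J" "y \<in> extensional ?J" "\<And>j. j \<in> ?J \<Longrightarrow> x j \<le> y j" "u \<le> v" for x y u v
  proof -
    have "y(i := v) \<in> D" if "x(i := u) \<in> D"
      using \<open>y \<in> extensional ?J\<close> \<open>u \<le> v\<close> \<open>\<And>j. j \<in> ?J \<Longrightarrow> x j \<le> y j\<close> i
      by (intro increasing_setD[OF D(2) that]) (auto simp: extensional_def)
    then show ?thesis by (auto split: split_indicator)
  qed
  have h_mono: "?h k u \<le> ?h k v" for k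
  proof -
    have "ennreal (?h k u) \<le> ennreal (?h k v)"
      unfolding ennreal_section_prob(1)[OF e] using \<open>u \<le> v\<close> by (intro tilt_integral_mono le) auto
    then show ?thesis by (subst (asm) ennreal_le_iff) (simp_all add: section_prob_def)
  qed
  have h_le: "?h False u \<le> ?h True u"
  proof -
    have "indicator D \<in> borel_measurable (\<Pi>\<^sub>M j\<in>insert i ?J. (borel :: real measure))"
      using D(1) unfolding ins by simp
    then have "ennreal (?h False u) \<le> ennreal (?h True u)"
      unfolding ennreal_section_prob(1)[OF e]
      by (intro tilt_integral_False_le_True[OF e] le fun_upd_section_measurable) auto
    then show ?thesis by (subst (asm) ennreal_le_iff) (simp_all add: section_prob_def)
  qed
  let ?t = "tilt e True"
  \<comment> \<open>As a convex combination in the weight of the upper coin, the expression is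
    increasing in that weight by \<open>h_le\<close>. The sections stay at \<open>u\<close> until
    the weights have moved to \<open>v\<close>.\<close>
  have "mixture_cond_prob e m D i u = ?h False u + ?t u * (?h True u - ?h False u)"
    by (simp add: mixture_cond_prob_def tilt_False algebra_simps)
  also have "\<dots> \<le> ?h False u + ?t v * (?h True u - ?h False u)"
    using monoD[OF tilt_True_mono[OF e(2)] \<open>u \<le> v\<close>] h_le by (intro add_left_mono mult_right_mono) auto
  also have "\<dots> = tilt e False v * ?h False u + ?t v * ?h True u"
    by (simp add: tilt_False algebra_simps)
  also have "\<dots> \<le> mixture_cond_prob e m D i v"
    unfolding mixture_cond_prob_def
    using tilt_pos[OF e] by (intro add_mono mult_left_mono h_mono) (auto intro: less_imp_le)
  finally show "mixture_cond_prob e m D i u \<le> mixture_cond_prob e m D i v" .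
qed

text \<open>The bounds make the candidate conditional probability integrable and allow its integrals
  to be computed as nonnegative ones.\<close>

lemma mixture_cond_prob_bounds:
  assumes e: "0 < e" "e \<le> 1 / 2"
  shows "0 \<le> mixture_cond_prob e m D i u" "mixture_cond_prob e m D i u \<le> 1"
proof -
  have h0: "0 \<le> section_prob e k m D i u" for k by (simp add: section_prob_def)
  show "0 \<le> mixture_cond_prob e m D i u"
    unfolding mixture_cond_prob_def using tilt_pos[OF e] h0 by (intro add_nonneg_nonneg mult_nonneg_nonneg) (auto intro: less_imp_le)
  have "mixture_cond_prob e m D i u \<le> tilt e False u * 1 + tilt e True u * 1"
    unfolding mixture_cond_prob_def
    by (intro add_mono mult_left_mono ennreal_section_prob(2)[OF e] less_imp_le tilt_pos[OF e])
  then show "mixture_cond_prob e m D i u \<le> 1" by (simp add: tilt_False)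
qed

text \<open>The monotone function \<open>mixture_cond_prob e m D i\<close> is a version of the
  conditional probability; this is checked through the defining integral identity over the
  sigma-algebra of coordinate \<open>i\<close>.\<close>

lemma PRDS_mixture:
  assumes e: "0 < e" "e \<le> 1 / 2"
  shows "PRDS (mixture e m) m {1..m} (\<lambda>i x. x i)"
  unfolding PRDS_def
proof (intro ballI impI exI conjI)
  fix D i
  assume D: "D \<in> sets (\<Pi>\<^sub>M i\<in>{1..m}. (borel :: real measure))" "increasing_set m D" and i: "i \<in> {1..m}"
  let ?M = "mixture e m" and ?g = "mixture_cond_prob e m D i"
  let ?F = "vimage_algebra (space ?M) (\<lambda>x. x i) borel"
  let ?D = "{x \<in> space ?M. pvector m (\<lambda>i x. x i) x \<in> D}"
  note mono = mono_mixture_cond_prob[OF e i D]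
  note bounds = mixture_cond_prob_bounds[OF e]
  show "mono_on {0..1} ?g"
    using mono by (auto simp: mono_def mono_on_def)
  interpret prob_space ?M
    by (rule prob_space_mixture[OF e])
  have comp [measurable]: "(\<lambda>x. x i) \<in> borel_measurable ?M"
    by (rule component_measurable_mixture[OF i])
  have g [measurable]: "?g \<in> borel_measurable borel"
    by (rule borel_measurable_mono[OF mono])
  have "?D = D"
    using sets.sets_into_space[OF D(1)] by (auto simp: pvector_mixture space_mixture space_PiM PiE_def pvector_def extensional_restrict)
  have [measurable]: "D \<in> sets ?M"
    using D(1) by (simp add: sets_mixture)
  have F: "sets ?F = {(\<lambda>x. x i) -` C \<inter> space ?M | C. C \<in> sets borel}"
    by (rule sets_vimage_algebra2) simp
  interpret finite_measure_subalgebra ?M ?F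
    by standard (auto simp: subalgebra_def F)
  have "AE x in ?M. real_cond_exp ?M ?F (indicator D) x = ?g (x i)"
  proof (rule real_cond_exp_charact)
    show "integrable ?M (indicator D :: _ \<Rightarrow> real)"
      by (rule integrable_real_indicator) (simp_all add: emeasure_eq_measure)
    show "integrable ?M (\<lambda>x. ?g (x i))"
      by (rule integrable_const_bound[where B = 1]) (use bounds in auto)
    show "(\<lambda>x. ?g (x i)) \<in> borel_measurable ?F"
      by (rule measurable_compose[OF _ g]) (auto intro: measurable_vimage_algebra1)
  next
    \<comment> \<open>Each test set is the preimage of a Borel set \<open>C\<close> under coordinate
      \<open>i\<close>, so disintegrating along this coordinate evaluates both sides.\<close>
    fix A assume "A \<in> sets ?F"
    then obtain C where A: "A = (\<lambda>x. x i) -` C \<inter> space ?M" and [measurable]: "C \<in> sets borel"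
      unfolding F by blast
    have [measurable]: "A \<in> sets ?M" unfolding A by measurable
    have ind: "(\<lambda>x. indicator C (x i) * indicator D x :: ennreal) \<in> borel_measurable (\<Pi>\<^sub>M j\<in>{1..m}. borel)"
      using i D(1) by measurable
    have "(\<integral>\<^sup>+x. ennreal (indicator A x * indicator D x) \<partial>?M) =
        (\<integral>\<^sup>+x. indicator C (x i) * indicator D x \<partial>?M)"
      by (intro nn_integral_cong) (auto simp: A split: split_indicator)
    also have "\<dots> = (\<integral>\<^sup>+u. indicator {0..1} u * (indicator C u * ennreal (?g u)) \<partial>lborel)"
    proof (subst nn_integral_mixture_disintegrate[OF e i ind], intro nn_integral_cong arg_cong2[where f = "(*)"] refl)
      fix u
      \<comment> \<open>Overwriting coordinate \<open>i\<close> by \<open>u\<close> turns the first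
        factor into the constant \<open>indicator C u\<close>, leaving the section integral of
        \<open>D\<close>.\<close>
      have eq: "tilt_integral e k ({1..m} - {i}) (\<lambda>y. indicator C ((y(i := u)) i) * indicator D (y(i := u))) =
          indicator C u * ennreal (section_prob e k m D i u)" for k
        unfolding ennreal_section_prob(1)[OF e]
        by (auto simp: tilt_integral_const[OF e] split: split_indicator)
      show "ennreal (tilt e False u) * tilt_integral e False ({1..m} - {i})
            (\<lambda>y. indicator C ((y(i := u)) i) * indicator D (y(i := u))) +
          ennreal (tilt e True u) * tilt_integral e True ({1..m} - {i})
            (\<lambda>y. indicator C ((y(i := u)) i) * indicator D (y(i := u))) =
          indicator C u * ennreal (?g u)"
        unfolding eq mixture_cond_prob_def using tilt_pos[OF e]
        by (auto simp: ennreal_mult less_imp_le section_prob_def split: split_indicator)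
    qed
    also have "\<dots> = (\<integral>\<^sup>+x. indicator C (x i) * ennreal (?g (x i)) \<partial>?M)"
      by (rule nn_integral_mixture_component[OF e i, symmetric]) simp
    also have "\<dots> = (\<integral>\<^sup>+x. ennreal (indicator A x * ?g (x i)) \<partial>?M)"
      by (intro nn_integral_cong) (auto simp: A split: split_indicator)
    finally show "(\<integral>x\<in>A. indicator D x \<partial>?M) = (\<integral>x\<in>A. ?g (x i) \<partial>?M)"
      unfolding set_lebesgue_integral_def
      by (simp add: integral_eq_nn_integral bounds)
  qed
  then show "AE x in ?M. real_cond_exp ?M ?F (indicator ?D) x = ?g (x i)"
    by (simp only: \<open>?D = D\<close>)
qed

section \<open>Which inputs the count rule rejects\<close>

lemma tail_pos_le: "tail_pos m W t \<le> m"
  unfolding tail_pos_def by (rule order_trans[OF card_mono[of "{1..m}"]]) auto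

lemma tail_neg_le: "tail_neg m W t \<le> m"
  unfolding tail_neg_def by (rule order_trans[OF card_mono[of "{1..m}"]]) auto

text \<open>There are finitely many admissible thresholds, so their minimum lies below
  \<open>W i\<close> exactly when one of them does; an infinite threshold is the case where none
  exists. This form has no minimum left and exhibits rejection as a finite disjunction.\<close>

lemma mem_count_rule_iff:
  "i \<in> count_rule m \<psi> q W \<longleftrightarrow> i \<in> {1..m} \<and>
    (\<exists>j\<in>{1..m}. 0 < \<bar>W j\<bar> \<and> \<psi> (tail_pos m W \<bar>W j\<bar>) (tail_neg m W \<bar>W j\<bar>) \<le> ennreal q \<and> \<bar>W j\<bar> \<le> W i)"
proof -
  define T where "T = {t \<in> thresholds m W. \<psi> (tail_pos m W t) (tail_neg m W t) \<le> ennreal q}"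
  have "thresholds m W \<subseteq> (\<lambda>i. \<bar>W i\<bar>) ` {1..m}"
    by (auto simp: thresholds_def)
  then have "finite T"
    by (auto simp: T_def intro: finite_subset)
  then have "i \<in> count_rule m \<psi> q W \<longleftrightarrow> i \<in> {1..m} \<and> (\<exists>t\<in>T. t \<le> W i)"
    by (auto simp: count_rule_def count_threshold_def Let_def T_def[symmetric] Min_le_iff)
  then show ?thesis
    unfolding T_def thresholds_def by blast
qed

text \<open>By monotonicity \<psi> is smallest at the counts \<open>(m, 0)\<close>; if it exceeds
  \<open>q\<close> there, no threshold is ever admissible.\<close>

lemma count_rule_eq_empty:
  assumes "\<And>b. b \<in> {0..m} \<Longrightarrow> antimono_on {0..m} (\<lambda>a. \<psi> a b)"
    and "\<And>a. a \<in> {0..m} \<Longrightarrow> mono_on {0..m} (\<lambda>b. \<psi> a b)"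
    and "\<psi> m 0 > ennreal q"
  shows "count_rule m \<psi> q W = {}"
proof -
  have "ennreal q < \<psi> a b" if "a \<le> m" "b \<le> m" for a b
  proof -
    have "\<psi> m 0 \<le> \<psi> m b"
      using assms(2)[of m] that by (auto simp: monotone_on_def)
    also have "\<dots> \<le> \<psi> a b"
      using assms(1)[of b] that by (auto simp: monotone_on_def)
    finally show ?thesis using assms(3) by simp
  qed
  from this[OF tail_pos_le tail_neg_le] show ?thesis
    by (auto simp: mem_count_rule_iff simp flip: not_less)
qed

lemma count_rule_nonempty:
  assumes "m \<ge> 1" and pos: "\<And>i. i \<in> {1..m} \<Longrightarrow> 0 < W i" and "\<psi> m 0 \<le> ennreal q"
  shows "count_rule m \<psi> q W \<noteq> {}"
proof -
  \<comment> \<open>The witness is the index of the smallest score: all scores reach it, and none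
    lies below its negative since all are positive.\<close>
  have "Min (W ` {1..m}) \<in> W ` {1..m}"
    using \<open>m \<ge> 1\<close> by (intro Min_in) auto
  then obtain j where j: "j \<in> {1..m}" "W j = Min (W ` {1..m})" by auto
  then have le: "W j \<le> W i" if "i \<in> {1..m}" for i
    using that by simp
  have "{i \<in> {1..m}. W i \<ge> W j} = {1..m}"
    using le by auto
  moreover have "{i \<in> {1..m}. W i \<le> - W j} = {}"
    using pos[OF j(1)] pos by force
  ultimately have "tail_pos m W (W j) = m" "tail_neg m W (W j) = 0"
    unfolding tail_pos_def tail_neg_def by simp_all
  then have "j \<in> count_rule m \<psi> q W"
    unfolding mem_count_rule_iff using j(1) pos[OF j(1)] \<open>\<psi> m 0 \<le> ennreal q\<close>
    by (intro conjI bexI[of _ j]) simp_all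
  then show ?thesis by blast
qed

section \<open>Measurability of the rejection event\<close>

lemma tail_counts_measurable:
  assumes "\<And>i. i \<in> {1..m} \<Longrightarrow> (\<lambda>x. W x i) \<in> borel_measurable M"
    and [measurable]: "t \<in> borel_measurable M"
  shows "(\<lambda>x. tail_pos m (W x) (t x)) \<in> measurable M (count_space UNIV)"
    and "(\<lambda>x. tail_neg m (W x) (t x)) \<in> measurable M (count_space UNIV)"
proof -
  have "{x \<in> space M. i \<in> {i \<in> {1..m}. t x \<le> W x i}} \<in> sets M"
    "{x \<in> space M. i \<in> {i \<in> {1..m}. W x i \<le> - t x}} \<in> sets M" for i
  proof -
    have "{x \<in> space M. t x \<le> W x i} \<in> sets M" "{x \<in> space M. W x i \<le> - t x} \<in> sets M" if "i \<in> {1..m}"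
      using assms(1)[OF that] by measurable
    then show "{x \<in> space M. i \<in> {i \<in> {1..m}. t x \<le> W x i}} \<in> sets M"
      "{x \<in> space M. i \<in> {i \<in> {1..m}. W x i \<le> - t x}} \<in> sets M"
      by (cases "i \<in> {1..m}"; simp)+
  qed
  then show "(\<lambda>x. tail_pos m (W x) (t x)) \<in> measurable M (count_space UNIV)"
    "(\<lambda>x. tail_neg m (W x) (t x)) \<in> measurable M (count_space UNIV)"
    unfolding tail_pos_def tail_neg_def by (simp_all only: measurable_card)
qed

lemma count_rule_nonempty_measurable:
  assumes W: "\<And>i. i \<in> {1..m} \<Longrightarrow> (\<lambda>x. W x i) \<in> borel_measurable M"
  shows "{x \<in> space M. count_rule m \<psi> q (W x) \<noteq> {}} \<in> sets M"
proof -
  let ?\<psi> = "\<lambda>j x. \<psi> (tail_pos m (W x) \<bar>W x j\<bar>) (tail_neg m (W x) \<bar>W x j\<bar>)"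
  have "{x \<in> space M. 0 < \<bar>W x j\<bar> \<and> ?\<psi> j x \<le> ennreal q \<and> \<bar>W x j\<bar> \<le> W x i} \<in> sets M"
    if "i \<in> {1..m}" "j \<in> {1..m}" for i j
  proof -
    note [measurable] = W[OF that(1)] W[OF that(2)]
    have t: "(\<lambda>x. \<bar>W x j\<bar>) \<in> borel_measurable M" by measurable
    \<comment> \<open>The function \<psi> is composed with two counts that take countably many
      values, so each argument is handled by a countable case split.\<close>
    have [measurable]: "?\<psi> j \<in> borel_measurable M"
      by (intro measurable_compose_countable[where g = "\<lambda>x. tail_pos m (W x) \<bar>W x j\<bar>" and f = "\<lambda>a x. \<psi> a (tail_neg m (W x) \<bar>W x j\<bar>)"]
          measurable_compose_countable[where g = "\<lambda>x. tail_neg m (W x) \<bar>W x j\<bar>" and f = "\<lambda>b x. \<psi> a b" for a]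
          tail_counts_measurable W t measurable_const) simp_all
    show ?thesis by measurable
  qed
  then have "(\<Union>i\<in>{1..m}. \<Union>j\<in>{1..m}.
      {x \<in> space M. 0 < \<bar>W x j\<bar> \<and> ?\<psi> j x \<le> ennreal q \<and> \<bar>W x j\<bar> \<le> W x i}) \<in> sets M"
    by (intro sets.finite_UN) auto
  also have "(\<Union>i\<in>{1..m}. \<Union>j\<in>{1..m}.
      {x \<in> space M. 0 < \<bar>W x j\<bar> \<and> ?\<psi> j x \<le> ennreal q \<and> \<bar>W x j\<bar> \<le> W x i}) =
      {x \<in> space M. count_rule m \<psi> q (W x) \<noteq> {}}"
    unfolding ex_in_conv[symmetric] mem_count_rule_iff by blast
  finally show ?thesis .
qed

lemma count_rule_rejects_measurable:
  "{x \<in> space (mixture e m). count_rule m \<psi> q (pvalue_scores x) \<noteq> {}} \<in> sets (mixture e m)"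
  unfolding pvalue_scores_def
  by (intro count_rule_nonempty_measurable borel_measurable_diff borel_measurable_const component_measurable_mixture)

section \<open>Lower bound for the false discovery rate\<close>

lemma FDR_mixture:
  "FDR (mixture e m) m \<psi> q {1..m} (\<lambda>i x. x i) =
    measure (mixture e m) {x \<in> space (mixture e m). count_rule m \<psi> q (pvalue_scores x) \<noteq> {}}"
    (is "_ = measure ?M ?R")
proof -
  have "FDR ?M m \<psi> q {1..m} (\<lambda>i x. x i) = (\<integral>x. indicator ?R x \<partial>?M)"
    unfolding FDR_def
  proof (intro Bochner_Integration.integral_cong refl)
    fix x assume x: "x \<in> space ?M"
    let ?C = "count_rule m \<psi> q (pvalue_scores (\<lambda>i. x i))"
    have "?C \<subseteq> {1..m}" by (auto simp: count_rule_def)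
    \<comment> \<open>Intersecting with the nulls changes nothing, and finiteness ensures that
      cardinality 0 means no rejection; there the maximum with 1 makes the ratio 0.\<close>
    then have "finite ?C" "?C \<inter> {1..m} = ?C" by (auto intro: finite_subset)
    then have "real (card ?C) / max (real (card ?C)) 1 = of_bool (?C \<noteq> {})"
      by (cases "card ?C") (auto simp: max_def)
    then show "(let R = ?C in real (card (R \<inter> {1..m})) / max (real (card R)) 1) = indicator ?R x"
      using x \<open>?C \<inter> {1..m} = ?C\<close> by (simp add: Let_def)
  qed
  then show ?thesis
    using sets.sets_into_space[OF count_rule_rejects_measurable[of e m \<psi> q]] by (simp add: Int_absorb2)
qed

text \<open>The lower coin alone gives the bound: a factor 1/2 for the coin and, by independence, a
  factor \<open>1 - e\<close> for each coordinate.\<close>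

lemma prob_all_below_half:
  assumes e: "0 < e" "e \<le> 1 / 2"
  shows "(1 - e) ^ m / 2 \<le> measure (mixture e m) {x \<in> space (mixture e m). \<forall>i\<in>{1..m}. x i < 1 / 2}"
    (is "_ \<le> measure ?M ?A")
proof -
  interpret prob_space ?M by (rule prob_space_mixture[OF e])
  \<comment> \<open>The event is encoded as a product of one-dimensional indicators so that its
    integral factorises.\<close>
  let ?\<phi> = "\<lambda>x. \<Prod>i\<in>{1..m}. indicator {..<1 / 2 :: real} (x i) :: ennreal"
  have \<phi>: "?\<phi> \<in> borel_measurable (\<Pi>\<^sub>M j\<in>{1..m}. borel)" by measurable
  have A: "?A \<in> sets ?M"
    using component_measurable_mixture[of _ m e] by measurable
  have "(\<integral>\<^sup>+u. indicator {..<1 / 2} u * ennreal (tilt_density e False u) \<partial>lborel) =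
      (\<integral>\<^sup>+u. ennreal (tilt_density e False u) * indicator {..<1 / 2} u \<partial>lborel)"
    by (simp add: mult.commute)
  also have "\<dots> = ennreal (2 * (1 - e)) * (\<integral>\<^sup>+u. indicator {0..<1 / 2 :: real} u \<partial>lborel)"
  proof -
    have "(\<lambda>u. indicator {..<1 / 2} u * indicator {0..<1 / 2} u) = (indicator {0..<1 / 2} :: real \<Rightarrow> ennreal)"
      "(\<lambda>u. indicator {..<1 / 2} u * indicator {1 / 2..1} u) = (\<lambda>_ :: real. 0 :: ennreal)"
      by (auto split: split_indicator)
    then show ?thesis
      by (subst nn_integral_tilt_density) (simp_all add: tilt_def)
  qed
  also have "\<dots> = ennreal (2 * (1 - e)) * ennreal (1 / 2)"
    by simp
  also have "\<dots> = ennreal (1 - e)"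
    using e by (simp del: ennreal_half flip: ennreal_mult)
  finally have one: "(\<integral>\<^sup>+u. indicator {..<1 / 2} u * ennreal (tilt_density e False u) \<partial>lborel) = ennreal (1 - e)" .
  have "ennreal ((1 - e) ^ m / 2) = ennreal (1 / 2) * ennreal (1 - e) ^ m"
    using e by (simp del: ennreal_half add: ennreal_power flip: ennreal_mult)
  also have "\<dots> = ennreal (1 / 2) * tilt_integral e False {1..m} ?\<phi>"
    by (subst tilt_integral_prod) (simp_all add: one)
  also have "\<dots> \<le> ennreal (1 / 2) * (tilt_integral e False {1..m} ?\<phi> + tilt_integral e True {1..m} ?\<phi>)"
    by (intro mult_left_mono) simp_all
  also have "\<dots> = (\<integral>\<^sup>+x. ?\<phi> x \<partial>?M)"
    by (rule nn_integral_mixture[OF e \<phi>, symmetric])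
  also have "\<dots> = (\<integral>\<^sup>+x. indicator ?A x \<partial>?M)"
  proof (rule nn_integral_cong)
    fix x assume x: "x \<in> space ?M"
    show "?\<phi> x = indicator ?A x"
    proof (cases "x \<in> ?A")
      case False
      then obtain i where "i \<in> {1..m}" "\<not> x i < 1 / 2" using x by auto
      then have "?\<phi> x = 0" by (intro prod_zero bexI[of _ i]) simp_all
      then show ?thesis using False by simp
    qed simp
  qed
  also have "\<dots> = ennreal (measure ?M ?A)"
    using A by (simp add: emeasure_eq_measure)
  finally show ?thesis
    by (subst (asm) ennreal_le_iff) simp_all
qed

lemma FDR_exceeds:
  assumes "m \<ge> 1" and "\<psi> m 0 \<le> ennreal q" and "c < 1 / 2"
  shows "\<exists>(M :: (nat \<Rightarrow> real) measure) P. all_null_uniform_PRDS M m P \<and> FDR M m \<psi> q {1..m} P > c"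
proof -
  \<comment> \<open>The second term gives \<open>m * e \<le> 1 / 2 - c\<close>, so Bernoulli's
    inequality yields \<open>(1 - e) ^ m \<ge> 1 / 2 + c\<close>, which exceeds \<open>2 * c\<close>
    because \<open>c < 1 / 2\<close>. The cap 1/2 keeps \<open>e\<close> admissible when
    \<open>c\<close> is small or negative.\<close>
  define e where "e = min (1 / 2) ((1 - 2 * c) / (2 * real m))"
  have e: "0 < e" "e \<le> 1 / 2"
    using assms unfolding e_def by (simp, intro min.cobounded1)
  interpret prob_space "mixture e m" by (rule prob_space_mixture[OF e])
  have "real m * e \<le> real m * ((1 - 2 * c) / (2 * real m))"
    unfolding e_def by (intro mult_left_mono) auto
  also have "\<dots> = (1 - 2 * c) / 2"
    using \<open>m \<ge> 1\<close> by (simp add: field_simps)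
  finally have "2 * c < 1 + real m * (- e)"
    using \<open>c < 1 / 2\<close> by (simp add: field_simps)
  also have "\<dots> \<le> (1 + (- e)) ^ m"
    using e by (intro Bernoulli_inequality) simp
  finally have "c < (1 - e) ^ m / 2" by simp
  also have "\<dots> \<le> prob {x \<in> space (mixture e m). \<forall>i\<in>{1..m}. x i < 1 / 2}"
    by (rule prob_all_below_half[OF e])
  also have "\<dots> \<le> prob {x \<in> space (mixture e m). count_rule m \<psi> q (pvalue_scores x) \<noteq> {}}"
    using count_rule_nonempty[where \<psi> = \<psi> and q = q, OF \<open>m \<ge> 1\<close> _ \<open>\<psi> m 0 \<le> ennreal q\<close>]
    by (intro finite_measure_mono count_rule_rejects_measurable) (auto simp: pvalue_scores_def)
  finally have "c < FDR (mixture e m) m \<psi> q {1..m} (\<lambda>i x. x i)"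
    by (simp only: FDR_mixture)
  moreover have "all_null_uniform_PRDS (mixture e m) m (\<lambda>i x. x i)"
    unfolding all_null_uniform_PRDS_def
    by (intro conjI prob_space_mixture exactly_uniform_mixture PRDS_mixture positive_joint_density_mixture e)
  ultimately show ?thesis by blast
qed

theorem proposition7:
  fixes q :: real and m :: nat and \<psi> :: "nat \<Rightarrow> nat \<Rightarrow> ennreal"
  assumes "0 < q" and "q < 1 / 2" and "m \<ge> 1"
    and "\<And>b. b \<in> {0..m} \<Longrightarrow> antimono_on {0..m} (\<lambda>a. \<psi> a b)"
    and "\<And>a. a \<in> {0..m} \<Longrightarrow> mono_on {0..m} (\<lambda>b. \<psi> a b)"
  shows "(\<psi> m 0 \<le> ennreal q \<longrightarrow>
           (\<forall>c < 1 / 2. \<exists>(M :: (nat \<Rightarrow> real) measure) P.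
              all_null_uniform_PRDS M m P \<and> FDR M m \<psi> q {1..m} P > c))
       \<and> (\<psi> m 0 > ennreal q \<longrightarrow> (\<forall>W :: nat \<Rightarrow> real. count_rule m \<psi> q W = {}))
       \<and> ((\<exists>(M :: (nat \<Rightarrow> real) measure) P.
              all_null_uniform_PRDS M m P \<and> FDR M m \<psi> q {1..m} P > q)
          \<or> (\<forall>W :: nat \<Rightarrow> real. count_rule m \<psi> q W = {}))"
proof (intro conjI impI allI)
  show "\<exists>(M :: (nat \<Rightarrow> real) measure) P. all_null_uniform_PRDS M m P \<and> FDR M m \<psi> q {1..m} P > c"
    if "\<psi> m 0 \<le> ennreal q" "c < 1 / 2" for c
    by (rule FDR_exceeds[where \<psi> = \<psi> and q = q, OF \<open>m \<ge> 1\<close> that])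
  show "count_rule m \<psi> q W = {}" if "\<psi> m 0 > ennreal q" for W
    by (rule count_rule_eq_empty[OF assms(4,5) that])
  \<comment> \<open>Since \<open>q < 1 / 2\<close>, the level \<open>q\<close> itself can be taken
    as the bound \<open>c\<close> when \<psi> at \<open>(m, 0)\<close> is at most
    \<open>q\<close>.\<close>
  then show "(\<exists>(M :: (nat \<Rightarrow> real) measure) P.
              all_null_uniform_PRDS M m P \<and> FDR M m \<psi> q {1..m} P > q)
          \<or> (\<forall>W :: nat \<Rightarrow> real. count_rule m \<psi> q W = {})"
    using FDR_exceeds[OF \<open>m \<ge> 1\<close>, of \<psi> q q] \<open>q < 1 / 2\<close> by (cases "\<psi> m 0 \<le> ennreal q") auto
qed

end
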